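(* For $(M^0,M^1)\in\mathcal M(\theta_0,\theta_1,\theta_\infty)$ let $x_0=m^0_{11}$, $x_1=m^1_{11}$, $x_2=\mathrm{tr}(M^1M^0)$. (1) For $(\hat M^0,\hat M^1)=e^{-\frac{\pi i}2\theta_\infty\sigma_3}S_2^{-1}(M^0,M^1)S_2e^{\frac{\pi i}2\theta_\infty\sigma_3}$ with $\hat M^j=(\hat m^j_{kl})$ ($j=0,1$), write $\hat x_0=\hat m^0_{22}$, $\hat x_1=\hat m^1_{22}$, $\hat x_2=\mathrm{tr}(\hat M^1\hat M^0)$. Then $(\hat x_0,\hat x_1,\hat x_2)\in\mathbf V_{(\theta_0,\theta_1,-\theta_\infty)}$, $(e^{-\pi i\theta_\infty}\hat x_1,e^{-\pi i\theta_\infty}\hat x_0,\hat x_2)\in\mathbf V_{(\theta_0,\theta_1,\theta_\infty)}$, and $$\hat x_0=e^{\pi i\theta_\infty}x_1,\quad\hat x_1=\mathrm{tr}M^1-e^{\pi i\theta_\infty}(x_1x_2+x_0-\mathrm{tr}M^0),\quad\hat x_2=x_2.$$ (2) For $(\check M^0,\check M^1)=e^{\frac{\pi i}2\theta_\infty\sigma_3}S_1(M^0,M^1)S_1^{-1}e^{-\frac{\pi i}2\theta_\infty\sigma_3}$ with $\check M^j=(\check m^j_{kl})$ ($j=0,1$), write $\check x_0=\check m^0_{22}$, $\check x_1=\check m^1_{22}$, $\check x_2=\mathrm{tr}(\check M^1\check M^0)$. Then $(\check x_0,\check x_1,\check x_2)\in\mathbf V_{(\theta_0,\theta_1,-\theta_\infty)}$,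 $(e^{-\pi i\theta_\infty}\check x_1,e^{-\pi i\theta_\infty}\check x_0,\check x_2)\in\mathbf V_{(\theta_0,\theta_1,\theta_\infty)}$, and $$\check x_0=\mathrm{tr}M^0-e^{\pi i\theta_\infty}(x_0x_2+x_1-\mathrm{tr}M^1),\quad\check x_1=e^{\pi i\theta_\infty}x_0,\quad\check x_2=x_2.$$
   Context: $\theta_0,\theta_1,\theta_\infty\in\mathbb{C}$; $\sigma_3=\mathrm{diag}(1,-1)$. $\mathcal M(\theta_0,\theta_1,\theta_\infty)$ is the set of pairs $(M^0,M^1)\in SL_2(\mathbb{C})^2$, $M^0=(m^0_{kl})$, $M^1=(m^1_{kl})$, satisfying $m^0_{11}m^1_{11}+m^0_{21}m^1_{12}=e^{-\pi i\theta_\infty}$, $\mathrm{tr}M^0=2\cos\pi\theta_0$, $\mathrm{tr}M^1=2\cos\pi\theta_1$, modulo $(M^0,M^1)\sim c^{\sigma_3}(M^0,M^1)c^{-\sigma_3}$, $c\in\mathbb{C}\setminus\{0\}$ (here $A(M^0,M^1)A^{-1}$ means $(AM^0A^{-1},AM^1A^{-1})$). The matrices $S_1=\begin{pmatrix}1&0\\ s_1&1\end{pmatrix}$, $S_2=\begin{pmatrix}1&s_2\\ 0&1\end{pmatrix}$ are determined by $M^1M^0=S_1^{-1}e^{-\pi i\theta_\infty\sigma_3}S_2^{-1}$, i.e. $s_2=-e^{\pi i\theta_\infty}(m^0_{12}m^1_{11}+m^0_{22}m^1_{12})$, $s_1=-e^{\pi i\theta_\infty}(m^0_{11}m^1_{21}+m^0_{21}m^1_{22})$.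 The character variety is $$\mathbf V_{(\theta_0,\theta_1,\theta_\infty)}:\ x_0x_1x_2+x_0^2+x_1^2-\mu_0(\theta_\infty)x_0-\mu_1(\theta_\infty)x_1-e^{-\pi i\theta_\infty}x_2+\kappa(\theta_\infty)=0,$$ where, with $T_0=2\cos\pi\theta_0$ $(=\mathrm{tr}M^0)$, $T_1=2\cos\pi\theta_1$ $(=\mathrm{tr}M^1)$, $\mu_0(\theta_\infty)=T_0+e^{-\pi i\theta_\infty}T_1$, $\mu_1(\theta_\infty)=T_1+e^{-\pi i\theta_\infty}T_0$, $\kappa(\theta_\infty)=e^{-2\pi i\theta_\infty}+e^{-\pi i\theta_\infty}T_0T_1+1$; $\mathbf V_{(\theta_0,\theta_1,-\theta_\infty)}$ is obtained by replacing $\theta_\infty$ by $-\theta_\infty$. *)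

theory Defs
  imports "HOL-Analysis.Analysis"
begin

type_synonym cmat2 = "complex^2^2"

definition mat2 :: "complex \<Rightarrow> complex \<Rightarrow> complex \<Rightarrow> complex \<Rightarrow> cmat2" where
  "mat2 a b c d = vector [vector [a, b], vector [c, d]]"

text \<open>The matrix power \<open>c ^ \<sigma>\<^sub>3\<close> and the matrix exponential
  \<open>exp (a \<sigma>\<^sub>3)\<close>, where \<open>\<sigma>\<^sub>3 = diag(1, -1)\<close>; in particular
  \<open>c ^ (-\<sigma>\<^sub>3)\<close> is \<open>matrix_inv (sigma3_pow c)\<close> for nonzero \<open>c\<close>.\<close>

definition sigma3_pow :: "complex \<Rightarrow> cmat2" where
  "sigma3_pow c = mat2 c 0 0 (inverse c)"

definition exp_sigma3 :: "complex \<Rightarrow> cmat2" where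
  "exp_sigma3 a = mat2 (exp a) 0 0 (exp (- a))"

definition monodromy_pairs :: "complex \<Rightarrow> complex \<Rightarrow> complex \<Rightarrow> (cmat2 \<times> cmat2) set" where
  "monodromy_pairs \<theta>0 \<theta>1 \<theta>inf =
    {(M0, M1). det M0 = 1 \<and> det M1 = 1 \<and>
       M0$1$1 * M1$1$1 + M0$2$1 * M1$1$2 = exp (- (of_real pi * \<i> * \<theta>inf)) \<and>
       trace M0 = 2 * cos (of_real pi * \<theta>0) \<and>
       trace M1 = 2 * cos (of_real pi * \<theta>1)}"

definition diag_conj_rel ::
    "complex \<Rightarrow> complex \<Rightarrow> complex \<Rightarrow> ((cmat2 \<times> cmat2) \<times> (cmat2 \<times> cmat2)) set" where
  "diag_conj_rel \<theta>0 \<theta>1 \<theta>inf =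
    {((M0, M1), (N0, N1)).
       (M0, M1) \<in> monodromy_pairs \<theta>0 \<theta>1 \<theta>inf \<and>
       (N0, N1) \<in> monodromy_pairs \<theta>0 \<theta>1 \<theta>inf \<and>
       (\<exists>c. c \<noteq> 0 \<and>
          N0 = sigma3_pow c ** M0 ** matrix_inv (sigma3_pow c) \<and>
          N1 = sigma3_pow c ** M1 ** matrix_inv (sigma3_pow c))}"

definition monodromy_manifold ::
    "complex \<Rightarrow> complex \<Rightarrow> complex \<Rightarrow> (cmat2 \<times> cmat2) set set" where
  "monodromy_manifold \<theta>0 \<theta>1 \<theta>inf =
    monodromy_pairs \<theta>0 \<theta>1 \<theta>inf // diag_conj_rel \<theta>0 \<theta>1 \<theta>inf"

definition stokes_S1 :: "complex \<Rightarrow> cmat2 \<Rightarrow> cmat2 \<Rightarrow> cmat2" where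
  "stokes_S1 \<theta>inf M0 M1 =
    mat2 1 0 (- exp (of_real pi * \<i> * \<theta>inf) * (M0$1$1 * M1$2$1 + M0$2$1 * M1$2$2)) 1"

definition stokes_S2 :: "complex \<Rightarrow> cmat2 \<Rightarrow> cmat2 \<Rightarrow> cmat2" where
  "stokes_S2 \<theta>inf M0 M1 =
    mat2 1 (- exp (of_real pi * \<i> * \<theta>inf) * (M0$1$2 * M1$1$1 + M0$2$2 * M1$1$2)) 0 1"

definition char_variety :: "complex \<Rightarrow> complex \<Rightarrow> complex \<Rightarrow> (complex \<times> complex \<times> complex) set" where
  "char_variety \<theta>0 \<theta>1 \<theta>inf =
    (let T0 = 2 * cos (of_real pi * \<theta>0);
         T1 = 2 * cos (of_real pi * \<theta>1);
         e = exp (- (of_real pi * \<i> * \<theta>inf));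
         \<mu>0 = T0 + e * T1;
         \<mu>1 = T1 + e * T0;
         \<kappa> = exp (- (2 * of_real pi * \<i> * \<theta>inf)) + e * T0 * T1 + 1
     in {(x0, x1, x2).
           x0 * x1 * x2 + x0\<^sup>2 + x1\<^sup>2 - \<mu>0 * x0 - \<mu>1 * x1 - e * x2 + \<kappa> = 0})"

lemma mat2_nth [simp]:
  "mat2 a b c d $ 1 $ 1 = a" "mat2 a b c d $ 1 $ 2 = b"
  "mat2 a b c d $ 2 $ 1 = c" "mat2 a b c d $ 2 $ 2 = d"
  by (simp_all add: mat2_def)

lemma mat2_mult: "mat2 a b c d ** mat2 a' b' c' d' =
    mat2 (a * a' + b * c') (a * b' + b * d') (c * a' + d * c') (c * b' + d * d')"
  by (simp add: vec_eq_iff forall_2 matrix_matrix_mult_def sum_2)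

lemma mat2_eta: "M = mat2 (M$1$1) (M$1$2) (M$2$1) (M$2$2)"
  by (simp add: vec_eq_iff forall_2)

lemma mat2_inject: "mat2 a b c d = mat2 a' b' c' d' \<longleftrightarrow> a = a' \<and> b = b' \<and> c = c' \<and> d = d'"
  by (auto simp: vec_eq_iff forall_2)

lemma mat2_one: "mat 1 = mat2 1 0 0 1"
  by (simp add: vec_eq_iff forall_2 mat_def)

lemma mat2_inv:
  assumes "a * d - b * c = 1"
  shows "matrix_inv (mat2 a b c d) = mat2 d (- b) (- c) a"
proof -
  let ?A = "mat2 a b c d" and ?B = "mat2 d (- b) (- c) a"
  have AB: "?A ** ?B = mat 1" "?B ** ?A = mat 1"
    using assms by (simp_all add: mat2_mult mat2_one mat2_inject algebra_simps)
  have "?A ** matrix_inv ?A = mat 1 \<and> matrix_inv ?A ** ?A = mat 1"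
    unfolding matrix_inv_def by (rule someI[of _ ?B]) (use AB in simp)
  then show ?thesis
    by (metis AB(2) matrix_mul_assoc matrix_mul_lid matrix_mul_rid)
qed

lemma matrix_inv_sigma3_pow: "c \<noteq> 0 \<Longrightarrow> matrix_inv (sigma3_pow c) = sigma3_pow (inverse c)"
  by (simp add: sigma3_pow_def mat2_inv)

lemma sigma3_pow_conj:
  assumes "c \<noteq> 0"
  shows "sigma3_pow c ** M ** matrix_inv (sigma3_pow c) =
    mat2 (M$1$1) (c\<^sup>2 * M$1$2) (M$2$1 / c\<^sup>2) (M$2$2)"
  using assms
  by (subst mat2_eta[of M])
    (simp add: matrix_inv_sigma3_pow, simp add: sigma3_pow_def mat2_mult mat2_inject power2_eq_square divide_inverse mult_ac)

text \<open>The relation divided out is an equivalence, and the functions \<open>x\<^sub>0\<close>, \<open>x\<^sub>1\<close>, \<open>x\<^sub>2\<close>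
  do not depend on the representative.\<close>

lemma diag_conj_rel_iff:
  "(p, q) \<in> diag_conj_rel \<theta>0 \<theta>1 \<theta>inf \<longleftrightarrow>
     p \<in> monodromy_pairs \<theta>0 \<theta>1 \<theta>inf \<and> q \<in> monodromy_pairs \<theta>0 \<theta>1 \<theta>inf \<and>
     (\<exists>c. c \<noteq> 0 \<and> (\<forall>f\<in>{fst, snd}.
        f q = mat2 (f p $ 1 $ 1) (c\<^sup>2 * f p $ 1 $ 2) (f p $ 2 $ 1 / c\<^sup>2) (f p $ 2 $ 2)))"
  by (cases p; cases q) (simp add: diag_conj_rel_def sigma3_pow_conj cong: conj_cong)

lemma equiv_diag_conj_rel:
  "equiv (monodromy_pairs \<theta>0 \<theta>1 \<theta>inf) (diag_conj_rel \<theta>0 \<theta>1 \<theta>inf)"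
proof (rule equivI)
  show "diag_conj_rel \<theta>0 \<theta>1 \<theta>inf \<subseteq> monodromy_pairs \<theta>0 \<theta>1 \<theta>inf \<times> monodromy_pairs \<theta>0 \<theta>1 \<theta>inf"
    by (auto simp: diag_conj_rel_def)
  show "refl_on (monodromy_pairs \<theta>0 \<theta>1 \<theta>inf) (diag_conj_rel \<theta>0 \<theta>1 \<theta>inf)"
    by (auto simp: refl_on_def diag_conj_rel_iff mat2_eta[symmetric] intro!: exI[of _ 1])
  show "sym (diag_conj_rel \<theta>0 \<theta>1 \<theta>inf)"
  proof (rule symI)
    fix p q assume "(p, q) \<in> diag_conj_rel \<theta>0 \<theta>1 \<theta>inf"
    then obtain c where pq: "p \<in> monodromy_pairs \<theta>0 \<theta>1 \<theta>inf" "q \<in> monodromy_pairs \<theta>0 \<theta>1 \<theta>inf"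
      and c: "c \<noteq> 0" "\<And>f. f \<in> {fst, snd} \<Longrightarrow>
        f q = mat2 (f p $ 1 $ 1) (c\<^sup>2 * f p $ 1 $ 2) (f p $ 2 $ 1 / c\<^sup>2) (f p $ 2 $ 2)"
      unfolding diag_conj_rel_iff by blast
    have "f p = mat2 (f q $ 1 $ 1) ((inverse c)\<^sup>2 * f q $ 1 $ 2) (f q $ 2 $ 1 / (inverse c)\<^sup>2) (f q $ 2 $ 2)"
      if "f \<in> {fst, snd}" for f
      unfolding c(2)[OF that] using c(1)
      by (subst mat2_eta[of "f p"]) (simp add: mat2_inject power_inverse divide_inverse)
    then show "(q, p) \<in> diag_conj_rel \<theta>0 \<theta>1 \<theta>inf"
      unfolding diag_conj_rel_iff using pq c(1) by (meson inverse_zero_imp_zero)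
  qed
  show "trans (diag_conj_rel \<theta>0 \<theta>1 \<theta>inf)"
  proof (rule transI)
    fix p q r
    assume "(p, q) \<in> diag_conj_rel \<theta>0 \<theta>1 \<theta>inf" "(q, r) \<in> diag_conj_rel \<theta>0 \<theta>1 \<theta>inf"
    then obtain c d where pr: "p \<in> monodromy_pairs \<theta>0 \<theta>1 \<theta>inf" "r \<in> monodromy_pairs \<theta>0 \<theta>1 \<theta>inf"
      and c: "c \<noteq> 0" "\<And>f. f \<in> {fst, snd} \<Longrightarrow>
        f q = mat2 (f p $ 1 $ 1) (c\<^sup>2 * f p $ 1 $ 2) (f p $ 2 $ 1 / c\<^sup>2) (f p $ 2 $ 2)"
      and d: "d \<noteq> 0" "\<And>f. f \<in> {fst, snd} \<Longrightarrow>
        f r = mat2 (f q $ 1 $ 1) (d\<^sup>2 * f q $ 1 $ 2) (f q $ 2 $ 1 / d\<^sup>2) (f q $ 2 $ 2)"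
      unfolding diag_conj_rel_iff by blast
    have "f r = mat2 (f p $ 1 $ 1) ((d * c)\<^sup>2 * f p $ 1 $ 2) (f p $ 2 $ 1 / (d * c)\<^sup>2) (f p $ 2 $ 2)"
      if "f \<in> {fst, snd}" for f
      unfolding d(2)[OF that] c(2)[OF that] by (simp add: mat2_inject power_mult_distrib mult_ac)
    then show "(p, r) \<in> diag_conj_rel \<theta>0 \<theta>1 \<theta>inf"
      unfolding diag_conj_rel_iff using pr c(1) d(1) by (meson no_zero_divisors)
  qed
qed

lemma coordinates_respect:
  assumes "((M0, M1), (N0, N1)) \<in> diag_conj_rel \<theta>0 \<theta>1 \<theta>inf"
  shows "N0$1$1 = M0$1$1 \<and> N1$1$1 = M1$1$1 \<and> trace (N1 ** N0) = trace (M1 ** M0)"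
proof -
  obtain c where "c \<noteq> 0"
    "N0 = mat2 (M0$1$1) (c\<^sup>2 * M0$1$2) (M0$2$1 / c\<^sup>2) (M0$2$2)"
    "N1 = mat2 (M1$1$1) (c\<^sup>2 * M1$1$2) (M1$2$1 / c\<^sup>2) (M1$2$2)"
    using assms by (auto simp: diag_conj_rel_iff)
  then show ?thesis
    by (simp add: trace_def sum_2 matrix_matrix_mult_def)
qed

text \<open>The entries of \<open>stokes_S1\<close> and \<open>stokes_S2\<close> are the only ones for which the triangular
  factorisation of \<open>M1 ** M0\<close> holds.\<close>

lemma stokes_factorisation:
  assumes "(M0, M1) \<in> monodromy_pairs \<theta>0 \<theta>1 \<theta>inf"
  shows "M1 ** M0 = matrix_inv (mat2 1 0 s1 1) ** exp_sigma3 (- (of_real pi * \<i> * \<theta>inf))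
             ** matrix_inv (mat2 1 s2 0 1) \<longleftrightarrow>
         mat2 1 0 s1 1 = stokes_S1 \<theta>inf M0 M1 \<and> mat2 1 s2 0 1 = stokes_S2 \<theta>inf M0 M1"
proof -
  define e where "e = exp (- (of_real pi * \<i> * \<theta>inf))"
  have e: "e \<noteq> 0" "exp (of_real pi * \<i> * \<theta>inf) = inverse e"
    by (simp_all add: e_def exp_minus)
  obtain a b c d where M0: "M0 = mat2 a b c d" by (metis mat2_eta)
  obtain p q r s where M1: "M1 = mat2 p q r s" by (metis mat2_eta)
  have det: "a * d - b * c = 1" "p * s - q * r = 1" and pa: "a * p + c * q = e"
    using assms by (simp_all add: monodromy_pairs_def M0 M1 det_2 e_def)
  have "(p * a + q * c) * (r * b + s * d) - (p * b + q * d) * (r * a + s * c) =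
      (a * d - b * c) * (p * s - q * r)"
    by algebra
  then have D: "e * (r * b + s * d) = 1 + (p * b + q * d) * (r * a + s * c)"
    using det pa by (simp add: algebra_simps)
  have lhs: "M1 ** M0 = mat2 e (p * b + q * d) (r * a + s * c) (r * b + s * d)"
    using pa by (simp add: M0 M1 mat2_mult algebra_simps)
  have rhs: "matrix_inv (mat2 1 0 s1 1) ** exp_sigma3 (- (of_real pi * \<i> * \<theta>inf))
      ** matrix_inv (mat2 1 s2 0 1) = mat2 e (- s2 * e) (- s1 * e) (s1 * s2 * e + inverse e)"
    by (simp add: mat2_inv exp_sigma3_def mat2_mult mat2_inject e e_def[symmetric])
  have last: "r * b + s * d = s1 * s2 * e + inverse e"
    if "p * b + q * d = - s2 * e" "r * a + s * c = - s1 * e"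
    using D e(1) unfolding that by (simp add: field_simps)
  have "u = - v * e \<longleftrightarrow> v = - inverse e * u" for u v :: complex
    using e(1) by (auto simp: field_simps)
  then have "p * b + q * d = - s2 * e \<longleftrightarrow> s2 = - inverse e * (b * p + d * q)"
    "r * a + s * c = - s1 * e \<longleftrightarrow> s1 = - inverse e * (a * r + c * s)"
    by (simp_all only: mult.commute[of b p] mult.commute[of d q] mult.commute[of a r] mult.commute[of c s])
  with last show ?thesis
    unfolding lhs rhs
    unfolding stokes_S1_def stokes_S2_def e(2) M0 M1 mat2_nth mat2_inject by blast
qed

end

theory Submission
  imports Defs
begin

text \<open>
  Write \<open>e = exp (- \<pi> \<i> \<theta>\<^sub>\<infinity>)\<close>. The point is that both conjugations
  act on the coordinates \<open>(x\<^sub>0, x\<^sub>1, x\<^sub>2)\<close> as the classical Vieta involutions of the cubic surface.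
  The cubic is quadratic and monic in \<open>x\<^sub>0\<close>, with roots adding up to \<open>\<mu>\<^sub>0 - x\<^sub>1 x\<^sub>2\<close>,
  so that \<open>x\<^sub>0 \<mapsto> \<mu>\<^sub>0 - x\<^sub>1 x\<^sub>2 - x\<^sub>0\<close> preserves it; likewise
  \<open>x\<^sub>1 \<mapsto> \<mu>\<^sub>1 - x\<^sub>0 x\<^sub>2 - x\<^sub>1\<close> (\<open>char_variety_vieta0\<close>, \<open>char_variety_vieta1\<close>).

  The coordinates of a monodromy pair lie on the cubic, because its equation follows from the two
  determinant conditions by eliminating the off-diagonal entries
  (\<open>monodromy_coordinates_in_char_variety\<close>).
  Conjugating by \<open>S\<^sub>2\<close> (or \<open>S\<^sub>1\<close>) leaves \<open>x\<^sub>2\<close> unchanged, being a trace, and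
  the lower right entries of the new matrices, multiplied by \<open>e\<close>, are up to order one old coordinate
  and the Vieta partner of the other (\<open>stokes_S2_entries\<close>, \<open>stokes_S1_entries\<close>).
  Finally, the substitution \<open>(y\<^sub>0, y\<^sub>1, y\<^sub>2) \<mapsto> (e y\<^sub>1, e y\<^sub>0, y\<^sub>2)\<close> identifies the surface for
  \<open>- \<theta>\<^sub>\<infinity>\<close> with the one for \<open>\<theta>\<^sub>\<infinity>\<close>, as it multiplies the equation by
  \<open>e\<^sup>2\<close> (\<open>char_variety_uminus_iff\<close>).
\<close>

lemma mem_char_variety:
  assumes "e = exp (- (of_real pi * \<i> * \<theta>inf))"
    and "T0 = 2 * cos (of_real pi * \<theta>0)" and "T1 = 2 * cos (of_real pi * \<theta>1)"
  shows "(x0, x1, x2) \<in> char_variety \<theta>0 \<theta>1 \<theta>inf \<longleftrightarrow>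
    x0 * x1 * x2 + x0\<^sup>2 + x1\<^sup>2 - (T0 + e * T1) * x0 - (T1 + e * T0) * x1 - e * x2
      + (e\<^sup>2 + e * T0 * T1 + 1) = 0"
proof -
  have "exp (- (2 * of_real pi * \<i> * \<theta>inf)) = e\<^sup>2"
    unfolding assms(1) power2_eq_square exp_add[symmetric] by (simp add: algebra_simps)
  then show ?thesis
    by (simp add: char_variety_def Let_def assms)
qed

text \<open>The sum of the roots of the equation, viewed as a monic quadratic in \<open>x0\<close>, is
  \<open>T0 + e * T1 - x1 * x2\<close>; the new first coordinate is the other root.\<close>

lemma char_variety_vieta0:
  assumes "e = exp (- (of_real pi * \<i> * \<theta>inf))"
    and "T0 = 2 * cos (of_real pi * \<theta>0)" and "T1 = 2 * cos (of_real pi * \<theta>1)"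
    and "(x0, x1, x2) \<in> char_variety \<theta>0 \<theta>1 \<theta>inf"
  shows "(T0 + e * T1 - x1 * x2 - x0, x1, x2) \<in> char_variety \<theta>0 \<theta>1 \<theta>inf"
  using assms(4) unfolding mem_char_variety[OF assms(1-3)] by algebra

lemma char_variety_vieta1:
  assumes "e = exp (- (of_real pi * \<i> * \<theta>inf))"
    and "T0 = 2 * cos (of_real pi * \<theta>0)" and "T1 = 2 * cos (of_real pi * \<theta>1)"
    and "(x0, x1, x2) \<in> char_variety \<theta>0 \<theta>1 \<theta>inf"
  shows "(x0, T1 + e * T0 - x0 * x2 - x1, x2) \<in> char_variety \<theta>0 \<theta>1 \<theta>inf"
  using assms(4) unfolding mem_char_variety[OF assms(1-3)] by algebra

text \<open>Multiplying the equation for \<open>- \<theta>inf\<close> by \<open>e\<^sup>2\<close> turns its coefficients, in which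
  \<open>inverse e\<close> replaces \<open>e\<close>, into those for \<open>\<theta>inf\<close> with the first two variables interchanged.\<close>

lemma char_variety_uminus_iff:
  assumes "e = exp (- (of_real pi * \<i> * \<theta>inf))"
  shows "(y0, y1, y2) \<in> char_variety \<theta>0 \<theta>1 (- \<theta>inf) \<longleftrightarrow>
    (e * y1, e * y0, y2) \<in> char_variety \<theta>0 \<theta>1 \<theta>inf"
proof -
  define T0 where "T0 = 2 * cos (of_real pi * \<theta>0)"
  define T1 where "T1 = 2 * cos (of_real pi * \<theta>1)"
  have e: "e \<noteq> 0" and inv: "inverse e = exp (- (of_real pi * \<i> * (- \<theta>inf)))"
    by (simp_all add: assms exp_minus)
  define P where "P = y0 * y1 * y2 + y0\<^sup>2 + y1\<^sup>2 - (T0 + inverse e * T1) * y0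
      - (T1 + inverse e * T0) * y1 - inverse e * y2
      + ((inverse e)\<^sup>2 + inverse e * T0 * T1 + 1)"
  have "(e * y1) * (e * y0) * y2 + (e * y1)\<^sup>2 + (e * y0)\<^sup>2 - (T0 + e * T1) * (e * y1)
      - (T1 + e * T0) * (e * y0) - e * y2 + (e\<^sup>2 + e * T0 * T1 + 1) = e\<^sup>2 * P"
    using e unfolding P_def by (simp add: field_simps power2_eq_square)
  then show ?thesis
    unfolding mem_char_variety[OF inv T0_def T1_def] mem_char_variety[OF assms T0_def T1_def]
    using e by (simp add: P_def)
qed

lemma monodromy_manifold_representative:
  assumes "X \<in> monodromy_manifold \<theta>0 \<theta>1 \<theta>inf" and "p \<in> X"
  shows "p \<in> monodromy_pairs \<theta>0 \<theta>1 \<theta>inf"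
  using assms in_quotient_imp_subset[OF equiv_diag_conj_rel]
  unfolding monodromy_manifold_def by blast

text \<open>Once \<open>e\<close>, the traces and \<open>x2\<close> are written through the entries \<open>a, b, c, d\<close> of
  \<open>M0\<close> and \<open>p, q, r, s\<close> of \<open>M1\<close>, the left side of the cubic collapses to
  \<open>(a d - 1) (p s - 1) - (b c) (q r)\<close>, which vanishes because both determinants are one.\<close>

lemma monodromy_coordinates_in_char_variety:
  assumes "(M0, M1) \<in> monodromy_pairs \<theta>0 \<theta>1 \<theta>inf"
  shows "(M0$1$1, M1$1$1, trace (M1 ** M0)) \<in> char_variety \<theta>0 \<theta>1 \<theta>inf"
proof -
  define e where "e = exp (- (of_real pi * \<i> * \<theta>inf))"
  obtain a b c d where M0: "M0 = mat2 a b c d" by (metis mat2_eta)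
  obtain p q r s where M1: "M1 = mat2 p q r s" by (metis mat2_eta)
  have det: "a * d - b * c = 1" "p * s - q * r = 1" and e: "a * p + c * q = e"
    and T0: "a + d = 2 * cos (of_real pi * \<theta>0)" and T1: "p + s = 2 * cos (of_real pi * \<theta>1)"
    using assms by (simp_all add: monodromy_pairs_def M0 M1 det_2 e_def trace_def sum_2)
  have x2: "trace (M1 ** M0) = p * a + q * c + r * b + s * d"
    by (simp add: M0 M1 mat2_mult trace_def sum_2)
  have "a * p * (p * a + q * c + r * b + s * d) + a\<^sup>2 + p\<^sup>2
      - (a + d + (a * p + c * q) * (p + s)) * a - (p + s + (a * p + c * q) * (a + d)) * p
      - (a * p + c * q) * (p * a + q * c + r * b + s * d)
      + ((a * p + c * q)\<^sup>2 + (a * p + c * q) * (a + d) * (p + s) + 1)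
    = (a * d - 1) * (p * s - 1) - (b * c) * (q * r)"
    by (simp add: algebra_simps power2_eq_square)
  also have "\<dots> = 0"
  proof -
    have "a * d - 1 = b * c" "p * s - 1 = q * r"
      using det by (simp_all add: algebra_simps)
    then show ?thesis by (simp only: diff_self)
  qed
  finally show ?thesis
    unfolding x2 unfolding mem_char_variety[OF e_def T0 T1] M0 M1 mat2_nth e .
qed

lemma trace_mult_conj:
  fixes A B M N :: "'a::comm_semiring_1^'n^'n"
  assumes "B ** A = mat 1"
  shows "trace ((A ** N ** B) ** (A ** M ** B)) = trace (N ** M)"
proof -
  have "(A ** N ** B) ** (A ** M ** B) = A ** N ** (B ** A) ** M ** B"
    by (simp add: matrix_mul_assoc)
  also have "trace \<dots> = trace (B ** (A ** N ** M))"
    unfolding assms matrix_mul_rid by (rule trace_mul_sym)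
  also have "B ** (A ** N ** M) = N ** M"
    unfolding matrix_mul_assoc assms matrix_mul_lid ..
  finally show ?thesis .
qed

lemma exp_sigma3_inverse: "exp_sigma3 a ** exp_sigma3 (- a) = mat 1"
  by (simp add: exp_sigma3_def mat2_mult mat2_one mat2_inject flip: exp_add)

text \<open>Conjugation by a diagonal matrix leaves the diagonal entries alone, so only the unipotent
  factor shows up in the lower right entry.\<close>

lemma upper_conj:
  fixes M N :: cmat2 and u :: complex
  defines "S \<equiv> mat2 1 u 0 1"
  shows "(exp_sigma3 (- a) ** matrix_inv S ** M ** S ** exp_sigma3 a)$2$2 = M$2$2 + M$2$1 * u"
    and "trace ((exp_sigma3 (- a) ** matrix_inv S ** N ** S ** exp_sigma3 a) **
           (exp_sigma3 (- a) ** matrix_inv S ** M ** S ** exp_sigma3 a)) = trace (N ** M)"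
proof -
  obtain p q r s where M: "M = mat2 p q r s" by (metis mat2_eta)
  have "(exp_sigma3 (- a) ** matrix_inv S ** M ** S ** exp_sigma3 a)$2$2
      = (exp a * exp (- a)) * (s + r * u)"
    by (simp add: S_def M mat2_inv exp_sigma3_def mat2_mult algebra_simps)
  also have "exp a * exp (- a) = 1"
    by (simp flip: exp_add)
  finally show "(exp_sigma3 (- a) ** matrix_inv S ** M ** S ** exp_sigma3 a)$2$2 = M$2$2 + M$2$1 * u"
    by (simp add: M)
  have SS: "S ** matrix_inv S = mat 1"
    by (simp add: S_def mat2_inv mat2_mult mat2_one mat2_inject)
  have "(S ** exp_sigma3 a) ** (exp_sigma3 (- a) ** matrix_inv S)
      = S ** (exp_sigma3 a ** exp_sigma3 (- a)) ** matrix_inv S"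
    by (simp add: matrix_mul_assoc)
  also have "\<dots> = mat 1" by (simp add: exp_sigma3_inverse SS)
  finally have BA: "(S ** exp_sigma3 a) ** (exp_sigma3 (- a) ** matrix_inv S) = mat 1" .
  show "trace ((exp_sigma3 (- a) ** matrix_inv S ** N ** S ** exp_sigma3 a) **
      (exp_sigma3 (- a) ** matrix_inv S ** M ** S ** exp_sigma3 a)) = trace (N ** M)"
    using trace_mult_conj[OF BA, of N M] by (simp only: matrix_mul_assoc)
qed

lemma lower_conj:
  fixes M N :: cmat2 and u :: complex
  defines "S \<equiv> mat2 1 0 u 1"
  shows "(exp_sigma3 a ** S ** M ** matrix_inv S ** exp_sigma3 (- a))$2$2 = M$2$2 + M$1$2 * u"
    and "trace ((exp_sigma3 a ** S ** N ** matrix_inv S ** exp_sigma3 (- a)) **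
           (exp_sigma3 a ** S ** M ** matrix_inv S ** exp_sigma3 (- a))) = trace (N ** M)"
proof -
  obtain p q r s where M: "M = mat2 p q r s" by (metis mat2_eta)
  have "(exp_sigma3 a ** S ** M ** matrix_inv S ** exp_sigma3 (- a))$2$2
      = (exp a * exp (- a)) * (s + q * u)"
    by (simp add: S_def M mat2_inv exp_sigma3_def mat2_mult algebra_simps)
  also have "exp a * exp (- a) = 1"
    by (simp flip: exp_add)
  finally show "(exp_sigma3 a ** S ** M ** matrix_inv S ** exp_sigma3 (- a))$2$2 = M$2$2 + M$1$2 * u"
    by (simp add: M)
  have SS: "matrix_inv S ** S = mat 1"
    by (simp add: S_def mat2_inv mat2_mult mat2_one mat2_inject)
  have "(matrix_inv S ** exp_sigma3 (- a)) ** (exp_sigma3 a ** S)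
      = matrix_inv S ** (exp_sigma3 (- a) ** exp_sigma3 (- (- a))) ** S"
    by (simp add: matrix_mul_assoc)
  also have "\<dots> = mat 1" unfolding exp_sigma3_inverse by (simp add: SS)
  finally have BA: "(matrix_inv S ** exp_sigma3 (- a)) ** (exp_sigma3 a ** S) = mat 1" .
  show "trace ((exp_sigma3 a ** S ** N ** matrix_inv S ** exp_sigma3 (- a)) **
      (exp_sigma3 a ** S ** M ** matrix_inv S ** exp_sigma3 (- a))) = trace (N ** M)"
    using trace_mult_conj[OF BA, of N M] by (simp only: matrix_mul_assoc)
qed

text \<open>Since \<open>(M1 ** M0)$1$1 = e\<close>, the entry of \<open>S2\<close> is \<open>- (M1 ** M0)$1$2 / e\<close>. For the first
  matrix the numerator of the lower right entry is then \<open>M1$1$1 * det M0\<close>; for the second one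
  it reduces to traces by \<open>det M1 = 1\<close>. The cofactors in the proof come from making both sides
  homogeneous by means of \<open>E * (M1 ** M0)$1$1 = 1\<close>.\<close>

lemma stokes_S2_entries:
  assumes "(M0, M1) \<in> monodromy_pairs \<theta>0 \<theta>1 \<theta>inf"
  defines "E \<equiv> exp (of_real pi * \<i> * \<theta>inf)"
  defines "u \<equiv> - E * (M0$1$2 * M1$1$1 + M0$2$2 * M1$1$2)"
  shows "M0$2$2 + M0$2$1 * u = E * M1$1$1"
    and "M1$2$2 + M1$2$1 * u = trace M1 - E * (M1$1$1 * trace (M1 ** M0) + M0$1$1 - trace M0)"
proof -
  obtain a b c d where M0: "M0 = mat2 a b c d" by (metis mat2_eta)
  obtain p q r s where M1: "M1 = mat2 p q r s" by (metis mat2_eta)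
  have det: "a * d - b * c = 1" "p * s - q * r = 1" and e: "E * (a * p + c * q) = 1"
    using assms(1) by (simp_all add: monodromy_pairs_def M0 M1 det_2 E_def flip: exp_add)
  show "M0$2$2 + M0$2$1 * u = E * M1$1$1"
  proof -
    have "(d + c * (- E * (b * p + d * q))) - (E * p) =
        d * (1 - E * (a * p + c * q)) + E * p * ((a * d - b * c) - 1)"
      by (simp add: algebra_simps)
    also have "\<dots> = 0"
      unfolding det e by simp
    finally show ?thesis
      unfolding u_def M0 M1 mat2_nth right_minus_eq .
  qed
  have tr: "trace M0 = a + d" "trace M1 = p + s"
    "trace (M1 ** M0) = p * a + q * c + r * b + s * d"
    by (simp_all add: M0 M1 mat2_mult trace_def sum_2)
  show "M1$2$2 + M1$2$1 * u = trace M1 - E * (M1$1$1 * trace (M1 ** M0) + M0$1$1 - trace M0)"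
  proof -
    have "(s + r * (- E * (b * p + d * q)))
        - (p + s - E * (p * (p * a + q * c + r * b + s * d) + a - (a + d))) =
        p * (E * (a * p + c * q) - 1) + E * d * ((p * s - q * r) - 1)"
      by (simp add: algebra_simps)
    also have "\<dots> = 0"
      unfolding det e by simp
    finally show ?thesis
      unfolding tr unfolding u_def M0 M1 mat2_nth right_minus_eq .
  qed
qed

text \<open>The counterpart for \<open>S1\<close>, whose entry is \<open>- (M1 ** M0)$2$1 / e\<close>, with the roles of the two
  matrices exchanged.\<close>

lemma stokes_S1_entries:
  assumes "(M0, M1) \<in> monodromy_pairs \<theta>0 \<theta>1 \<theta>inf"
  defines "E \<equiv> exp (of_real pi * \<i> * \<theta>inf)"
  defines "u \<equiv> - E * (M0$1$1 * M1$2$1 + M0$2$1 * M1$2$2)"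
  shows "M0$2$2 + M0$1$2 * u = trace M0 - E * (M0$1$1 * trace (M1 ** M0) + M1$1$1 - trace M1)"
    and "M1$2$2 + M1$1$2 * u = E * M0$1$1"
proof -
  obtain a b c d where M0: "M0 = mat2 a b c d" by (metis mat2_eta)
  obtain p q r s where M1: "M1 = mat2 p q r s" by (metis mat2_eta)
  have det: "a * d - b * c = 1" "p * s - q * r = 1" and e: "E * (a * p + c * q) = 1"
    using assms(1) by (simp_all add: monodromy_pairs_def M0 M1 det_2 E_def flip: exp_add)
  have tr: "trace M0 = a + d" "trace M1 = p + s"
    "trace (M1 ** M0) = p * a + q * c + r * b + s * d"
    by (simp_all add: M0 M1 mat2_mult trace_def sum_2)
  show "M0$2$2 + M0$1$2 * u = trace M0 - E * (M0$1$1 * trace (M1 ** M0) + M1$1$1 - trace M1)"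
  proof -
    have "(d + b * (- E * (a * r + c * s)))
        - (a + d - E * (a * (p * a + q * c + r * b + s * d) + p - (p + s))) =
        a * (E * (a * p + c * q) - 1) + E * s * ((a * d - b * c) - 1)"
      by (simp add: algebra_simps)
    also have "\<dots> = 0"
      unfolding det e by simp
    finally show ?thesis
      unfolding tr unfolding u_def M0 M1 mat2_nth right_minus_eq .
  qed
  show "M1$2$2 + M1$1$2 * u = E * M0$1$1"
  proof -
    have "(s + q * (- E * (a * r + c * s))) - (E * a) =
        s * (1 - E * (a * p + c * q)) + E * a * ((p * s - q * r) - 1)"
      by (simp add: algebra_simps)
    also have "\<dots> = 0"
      unfolding det e by simp
    finally show ?thesis
      unfolding u_def M0 M1 mat2_nth right_minus_eq .
  qed
qed

theorem theorem2p18: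
  fixes \<theta>0 \<theta>1 \<theta>inf :: complex
    and X :: "(cmat2 \<times> cmat2) set"
    and M0 M1 S1 S2 hM0 hM1 cM0 cM1 :: cmat2
    and x0 x1 x2 hx0 hx1 hx2 cx0 cx1 cx2 :: complex
  assumes "X \<in> monodromy_manifold \<theta>0 \<theta>1 \<theta>inf"
    and "(M0, M1) \<in> X"
    and "x0 = M0$1$1" and "x1 = M1$1$1" and "x2 = trace (M1 ** M0)"
    and "S1 = stokes_S1 \<theta>inf M0 M1" and "S2 = stokes_S2 \<theta>inf M0 M1"
    and "hM0 = exp_sigma3 (- (of_real pi * \<i> / 2 * \<theta>inf)) ** matrix_inv S2 ** M0
                 ** S2 ** exp_sigma3 (of_real pi * \<i> / 2 * \<theta>inf)"
    and "hM1 = exp_sigma3 (- (of_real pi * \<i> / 2 * \<theta>inf)) ** matrix_inv S2 ** M1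
                 ** S2 ** exp_sigma3 (of_real pi * \<i> / 2 * \<theta>inf)"
    and "hx0 = hM0$2$2" and "hx1 = hM1$2$2" and "hx2 = trace (hM1 ** hM0)"
    and "cM0 = exp_sigma3 (of_real pi * \<i> / 2 * \<theta>inf) ** S1 ** M0
                 ** matrix_inv S1 ** exp_sigma3 (- (of_real pi * \<i> / 2 * \<theta>inf))"
    and "cM1 = exp_sigma3 (of_real pi * \<i> / 2 * \<theta>inf) ** S1 ** M1
                 ** matrix_inv S1 ** exp_sigma3 (- (of_real pi * \<i> / 2 * \<theta>inf))"
    and "cx0 = cM0$2$2" and "cx1 = cM1$2$2" and "cx2 = trace (cM1 ** cM0)"
  shows
    "((hx0, hx1, hx2) \<in> char_variety \<theta>0 \<theta>1 (- \<theta>inf) \<and>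
      (exp (- (of_real pi * \<i> * \<theta>inf)) * hx1, exp (- (of_real pi * \<i> * \<theta>inf)) * hx0, hx2)
        \<in> char_variety \<theta>0 \<theta>1 \<theta>inf \<and>
      hx0 = exp (of_real pi * \<i> * \<theta>inf) * x1 \<and>
      hx1 = trace M1 - exp (of_real pi * \<i> * \<theta>inf) * (x1 * x2 + x0 - trace M0) \<and>
      hx2 = x2) \<and>
     ((cx0, cx1, cx2) \<in> char_variety \<theta>0 \<theta>1 (- \<theta>inf) \<and>
      (exp (- (of_real pi * \<i> * \<theta>inf)) * cx1, exp (- (of_real pi * \<i> * \<theta>inf)) * cx0, cx2)
        \<in> char_variety \<theta>0 \<theta>1 \<theta>inf \<and>
      cx0 = trace M0 - exp (of_real pi * \<i> * \<theta>inf) * (x0 * x2 + x1 - trace M1) \<and>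
      cx1 = exp (of_real pi * \<i> * \<theta>inf) * x0 \<and>
      cx2 = x2)"
proof -
  define e where "e = exp (- (of_real pi * \<i> * \<theta>inf))"
  define E where "E = exp (of_real pi * \<i> * \<theta>inf)"
  have eE: "e * E = 1" unfolding e_def E_def by (simp flip: exp_add)
  have pair: "(M0, M1) \<in> monodromy_pairs \<theta>0 \<theta>1 \<theta>inf"
    using assms(1,2) by (rule monodromy_manifold_representative)
  then have T: "trace M0 = 2 * cos (of_real pi * \<theta>0)" "trace M1 = 2 * cos (of_real pi * \<theta>1)"
    by (simp_all add: monodromy_pairs_def)
  have V: "(x0, x1, x2) \<in> char_variety \<theta>0 \<theta>1 \<theta>inf"
    unfolding assms(3-5) using pair by (rule monodromy_coordinates_in_char_variety)

  have h: "hx0 = E * x1" "hx1 = trace M1 - E * (x1 * x2 + x0 - trace M0)" "hx2 = x2"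
    unfolding assms(3-12) stokes_S2_def upper_conj stokes_S2_entries[OF pair] E_def by (rule refl)+
  have "e * hx1 = trace M0 + e * trace M1 - x1 * x2 - x0" "e * hx0 = x1"
    unfolding h using eE by algebra+
  then have hV: "(e * hx1, e * hx0, hx2) \<in> char_variety \<theta>0 \<theta>1 \<theta>inf"
    using char_variety_vieta0[OF e_def T V] by (simp add: h(3))

  have c: "cx0 = trace M0 - E * (x0 * x2 + x1 - trace M1)" "cx1 = E * x0" "cx2 = x2"
    unfolding assms(3-7) assms(13-17) stokes_S1_def lower_conj stokes_S1_entries[OF pair] E_def
    by (rule refl)+
  have "e * cx1 = x0" "e * cx0 = trace M1 + e * trace M0 - x0 * x2 - x1"
    unfolding c using eE by algebra+
  then have cV: "(e * cx1, e * cx0, cx2) \<in> char_variety \<theta>0 \<theta>1 \<theta>inf"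
    using char_variety_vieta1[OF e_def T V] by (simp add: c(3))

  show ?thesis
    using hV cV h c unfolding char_variety_uminus_iff[OF e_def] e_def E_def by blast
qed

end
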